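(* Let $N\ge 1$ be an integer, let $a_0,a_1,\ldots,a_{N-1}\in\mathbb{R}$, and let $\mathrm{circ}(a_0,a_1,\ldots,a_{N-1})$ be the associated circulant matrix, with spectrum $$\lambda_m = \sum_{k=0}^{N-1} a_k e^{-\frac{2\pi j m k}{N}}, \qquad m=0,1,\ldots,N-1.$$ Let $\mathcal{T}_N$ be the $N\times N$ time-reversal matrix. Then $$R = \mathcal{T}_N\,\mathrm{circ}(a_0,a_1,\ldots,a_{N-1}) = \begin{bmatrix} a_1 & a_2 & a_3 & \cdots & a_{N-1} & a_0\\ a_2 & a_3 & a_4 & \cdots & a_0 & a_1\\ a_3 & a_4 & a_5 & \cdots & a_1 & a_2\\ \vdots & \vdots & \vdots & & \vdots & \vdots\\ a_{N-1} & a_0 & a_1 & \cdots & a_{N-3} & a_{N-2}\\ a_0 & a_1 & a_2 & \cdots & a_{N-2} & a_{N-1}\end{bmatrix}$$ is a reversed-circulant matrix (its $(p,q)$ entry is $a_{(p+q-1)\bmod N}$, $1\le p,q\le N$), and its $N$ eigenvalues $\lambda^{\mathcal{T}_N}_0,\ldots,\lambda^{\mathcal{T}_N}_{N-1}$, listed with multiplicity, are given by $$\lambda^{\mathcal{T}_N}_0 = \lambda_0,$$ $$\lambda^{\mathcal{T}_N}_m = -\lambda^{\mathcal{T}_N}_{N-m} = |\lambda_m|, \qquad 0<m<N/2,$$ $$\lambda^{\mathcal{T}_N}_{N/2} = -\lambda_{N/2} \quad \text{(this last case occurring only if } N \text{ is even)}.$$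
   Context: Here $j$ denotes the imaginary unit. The circulant matrix $\mathrm{circ}(a_0,a_1,\ldots,a_{N-1})\in\mathbb{R}^{N\times N}$ is the matrix with first row $(a_0,a_1,\ldots,a_{N-1})$ in which each row is the previous row cyclically shifted one position to the right; that is, its $(p,q)$ entry is $a_{(q-p)\bmod N}$, $1\le p,q\le N$. The time-reversal matrix $\mathcal{T}_N\in\mathbb{R}^{N\times N}$ is the involutory permutation matrix with ones on the anti-diagonal and zeros elsewhere: $(\mathcal{T}_N)_{p,q}=1$ if $p+q=N+1$ and $0$ otherwise. A reversed-circulant matrix is a matrix of the form $\mathcal{T}_N\,\mathrm{circ}(a_0,\ldots,a_{N-1})$. *)

theory Defs
  imports "Jordan_Normal_Form.Char_Poly"
begin

text \<open>Matrix indices start at 0 here, so row (or column) number \<open>p\<close> of a matrix \<open>A\<close> in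
  one-based notation has index \<open>p - 1\<close>.\<close>

text \<open>Only \<open>a 0, \<dots>, a (N - 1)\<close> matter. The difference is taken in \<open>int\<close>, as
  subtraction on \<open>nat\<close> truncates.\<close>
definition circ :: "nat \<Rightarrow> (nat \<Rightarrow> real) \<Rightarrow> real mat" where
  "circ N a = mat N N (\<lambda>(p, q). a (nat ((int q - int p) mod int N)))"

definition time_reversal :: "nat \<Rightarrow> real mat" where
  "time_reversal N = mat N N (\<lambda>(p, q). if (p + 1) + (q + 1) = N + 1 then 1 else 0)"

definition reversed_circulant :: "nat \<Rightarrow> real mat \<Rightarrow> bool" where
  "reversed_circulant N A \<longleftrightarrow> (\<exists>a. A = time_reversal N * circ N a)"

definition circ_eigenvalue :: "nat \<Rightarrow> (nat \<Rightarrow> real) \<Rightarrow> nat \<Rightarrow> complex" where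
  "circ_eigenvalue N a m =
     (\<Sum>k<N. complex_of_real (a k) *
        exp (- (2 * complex_of_real pi * \<i> * of_nat m * of_nat k) / of_nat N))"

text \<open>\<open>es\<close> lists all eigenvalues of the square matrix \<open>A\<close>, each as often as its (algebraic)
  multiplicity; in particular the characteristic polynomial splits over the base field.\<close>
definition eigenvalues_with_multiplicity :: "'a :: field mat \<Rightarrow> 'a list \<Rightarrow> bool" where
  "eigenvalues_with_multiplicity A es \<longleftrightarrow>
     square_mat A \<and> length es = dim_row A \<and> char_poly A = (\<Prod>e\<leftarrow>es. [:- e, 1:])"

end

theory Submission
  imports Defs
begin

text \<open>Let \<open>\<omega> = exp (2 \<pi> \<i> / N)\<close>, and let \<open>f\<^sub>m\<close> be the vector with entries
  \<open>f\<^sub>m(q) = \<omega>\<^bsup>-mq\<^esup>\<close>, where \<open>0 \<le> q < N\<close>. Reindexing the sum over a full period gives, for every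
  shift \<open>c\<close>,
  \<open>(\<Sum>q. a((q + c) mod N) \<omega>\<^bsup>-mq\<^esup>) = \<omega>\<^bsup>mc\<^esup> \<lambda>\<^sub>m\<close>
  (lemma \<open>cyclic_correlation_with_root_of_unity\<close>). With \<open>c = -p\<close> this is row \<open>p\<close> of the circulant
  matrix applied to \<open>f\<^sub>m\<close>, so \<open>f\<^sub>m\<close> is an eigenvector for \<open>\<lambda>\<^sub>m\<close>. With \<open>c = p + 1\<close> it is row \<open>p\<close>
  of the reversed matrix \<open>R\<close>, so that \<open>R f\<^sub>m = \<omega>\<^sup>m \<lambda>\<^sub>m f\<^bsub>-m\<^esub>\<close>: the reversal swaps the
  frequencies \<open>m\<close> and \<open>-m\<close>.

  The vectors \<open>f\<^sub>m\<close> and \<open>f\<^bsub>-m\<^esub>\<close> are complex conjugates, so real parts of rotated waves are the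
  natural candidates for eigenvectors of \<open>R\<close>. The real wave \<open>Re (exp (\<i>\<phi>) f\<^sub>m)\<close> is mapped to
  \<open>\<mu>\<close> times itself as soon as \<open>exp (2\<i>\<phi>) \<omega>\<^sup>m \<lambda>\<^sub>m\<close> is the real number \<open>\<mu>\<close>
  (lemma \<open>time_reversal_mult_circ_cosine_wave\<close>). For \<open>0 < m < N/2\<close>, a phase \<open>\<phi>\<close> that cancels the
  argument of \<open>\<omega>\<^sup>m \<lambda>\<^sub>m\<close> gives \<open>\<mu> = |\<lambda>\<^sub>m|\<close>. The entries of the matrix are real, hence
  \<open>\<omega>\<^bsup>N-m\<^esup> \<lambda>\<^bsub>N-m\<^esub>\<close> is the conjugate of \<open>\<omega>\<^sup>m \<lambda>\<^sub>m\<close>, and the phase \<open>\<pi>/2 - \<phi>\<close> for the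
  frequency \<open>N - m\<close> gives \<open>\<mu> = -|\<lambda>\<^sub>m|\<close>. At the self-conjugate frequencies \<open>0\<close> and \<open>N/2\<close> the
  number \<open>\<lambda>\<^sub>m\<close> is real and \<open>\<omega>\<^sup>m\<close> is \<open>1\<close> or \<open>-1\<close> respectively, which explains the two exceptional values.

  Multiplicities come from orthogonality. Two waves can only fail to be orthogonal if their
  frequencies are equal or opposite, and the phases chosen for opposite frequencies are complementary
  angles (lemma \<open>cosine_wave_orthogonality\<close>). Hence there are \<open>N\<close> linearly independent
  eigenvectors, and the characteristic polynomial is determined
  (lemma \<open>eigenvalues_from_biorthogonal_system\<close>).\<close>

section \<open>Diagonalization by a biorthogonal system\<close>

lemma char_poly_mat_diag:
  fixes f :: "nat \<Rightarrow> 'a :: field"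
  shows "char_poly (mat_diag n f) = (\<Prod>e\<leftarrow>map f [0..<n]. [:- e, 1:])"
proof -
  have "char_poly (mat_diag n f) = (\<Prod>e\<leftarrow>diag_mat (mat_diag n f). [:- e, 1:])"
    by (rule char_poly_upper_triangular[of _ n]) (auto simp: mat_diag_def)
  moreover have "diag_mat (mat_diag n f) = map f [0..<n]"
    by (auto simp: diag_mat_def mat_diag_def)
  ultimately show ?thesis by simp
qed

text \<open>A dual family \<open>u\<close> certifies that the eigenvectors \<open>v\<close> form a basis: up to the scaling by
  \<open>d\<close> it is the inverse of the matrix with columns \<open>v m\<close>, which therefore conjugates \<open>A\<close> to a
  diagonal matrix. Two families rather than one orthogonal family make the lemma usable over any
  field; over the complex numbers the dual family consists of the conjugates of the eigenvectors.\<close>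

lemma eigenvalues_from_biorthogonal_system:
  fixes A :: "'a :: field mat" and u v :: "nat \<Rightarrow> nat \<Rightarrow> 'a"
  assumes A: "A \<in> carrier_mat n n"
    and eigen: "\<And>m p. m < n \<Longrightarrow> p < n \<Longrightarrow> (\<Sum>q<n. A $$ (p, q) * v m q) = \<mu> m * v m p"
    and orth: "\<And>l m. l < n \<Longrightarrow> m < n \<Longrightarrow>
      (\<Sum>q<n. u l q * v m q) = (if l = m then d m else 0)"
    and nz: "\<And>m. m < n \<Longrightarrow> d m \<noteq> 0"
  shows "eigenvalues_with_multiplicity A (map \<mu> [0..<n])"
proof -
  define V where "V = mat n n (\<lambda>(q, m). v m q)"
  define U where "U = mat n n (\<lambda>(l, q). u l q / d l)"
  have V: "V \<in> carrier_mat n n" and U: "U \<in> carrier_mat n n"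
    by (auto simp: V_def U_def)
  have UV: "U * V = 1\<^sub>m n"
  proof (rule eq_matI)
    fix l m assume "l < dim_row (1\<^sub>m n :: 'a mat)" "m < dim_col (1\<^sub>m n :: 'a mat)"
    then have lm: "l < n" "m < n" by auto
    have "(U * V) $$ (l, m) = (\<Sum>q<n. u l q * v m q) / d l"
      using lm by (simp add: U_def V_def scalar_prod_def sum_divide_distrib lessThan_atLeast0)
    then show "(U * V) $$ (l, m) = 1\<^sub>m n $$ (l, m)"
      using lm nz orth by auto
  qed (use U V in auto)
  have VU: "V * U = 1\<^sub>m n"
    using mat_mult_left_right_inverse[OF U V UV] .
  have AV: "A * V = V * mat_diag n \<mu>"
  proof (rule eq_matI)
    fix p m assume "p < dim_row (V * mat_diag n \<mu>)" "m < dim_col (V * mat_diag n \<mu>)"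
    then have pm: "p < n" "m < n" using V by (auto simp: mat_diag_def)
    have "(A * V) $$ (p, m) = (\<Sum>q<n. A $$ (p, q) * v m q)"
      using pm A by (simp add: V_def scalar_prod_def lessThan_atLeast0)
    also have "\<dots> = v m p * \<mu> m" using eigen pm by simp
    also have "\<dots> = (V * mat_diag n \<mu>) $$ (p, m)"
      using pm unfolding mat_diag_mult_right[OF V] by (simp add: V_def)
    finally show "(A * V) $$ (p, m) = (V * mat_diag n \<mu>) $$ (p, m)" .
  qed (use A V in \<open>auto simp: mat_diag_def\<close>)
  have D: "mat_diag n \<mu> \<in> carrier_mat n n" by (simp add: mat_diag_def)
  have "A = A * (V * U)" using VU A by simp
  also have "\<dots> = V * mat_diag n \<mu> * U"
    using A V U AV by (metis assoc_mult_mat)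
  finally have "similar_mat A (mat_diag n \<mu>)"
    using similar_mat_witI[OF VU UV _ A D V U] by (auto simp: similar_mat_def)
  then have "char_poly A = char_poly (mat_diag n \<mu>)"
    by (rule char_poly_similar)
  then show ?thesis
    using A by (simp add: eigenvalues_with_multiplicity_def char_poly_mat_diag)
qed

section \<open>Roots of unity and cyclic sums\<close>

text \<open>The exponent is an integer because negative powers occur throughout.\<close>

definition root_of_unity :: "nat \<Rightarrow> int \<Rightarrow> complex" where
  "root_of_unity N k = cis (2 * pi * of_int k / of_nat N)"

lemma root_of_unity_add: "root_of_unity N (j + k) = root_of_unity N j * root_of_unity N k"
  by (simp add: root_of_unity_def cis_mult add_divide_distrib distrib_left)

lemma root_of_unity_0 [simp]: "root_of_unity N 0 = 1"
  by (simp add: root_of_unity_def)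

lemma norm_root_of_unity [simp]: "cmod (root_of_unity N k) = 1"
  by (simp add: root_of_unity_def)

lemma cnj_root_of_unity: "cnj (root_of_unity N k) = root_of_unity N (- k)"
  by (simp add: root_of_unity_def cis_cnj)

lemma root_of_unity_mult_nat: "root_of_unity N (k * int q) = root_of_unity N k ^ q"
  by (simp add: root_of_unity_def DeMoivre mult_ac)

lemma root_of_unity_multiple:
  assumes "N \<ge> 1" shows "root_of_unity N (int N * k) = 1"
proof -
  have "2 * pi * of_int (int N * k) / of_nat N = 2 * pi * of_int k"
    using assms by simp
  then have "root_of_unity N (int N * k) = cis (2 * pi * of_int k)"
    by (simp only: root_of_unity_def)
  then show ?thesis by (simp only: cis_multiple_2pi Ints_of_int)
qed

lemma root_of_unity_eq_1_iff:
  assumes "N \<ge> 1" shows "root_of_unity N k = 1 \<longleftrightarrow> int N dvd k"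
proof
  assume "root_of_unity N k = 1"
  then have "cos (2 * pi * of_int k / of_nat N) = 1"
    by (auto simp: root_of_unity_def complex_eq_iff)
  then obtain j :: int where "2 * pi * of_int k / of_nat N = of_int j * 2 * pi"
    by (auto simp: cos_one_2pi_int)
  then have "of_int k = real_of_int (j * int N)"
    using assms by (simp add: field_simps)
  then have "k = j * int N" by linarith
  then show "int N dvd k" by simp
qed (use assms root_of_unity_multiple in \<open>auto elim!: dvdE\<close>)

lemma root_of_unity_orthogonality:
  assumes "N \<ge> 1"
  shows "(\<Sum>q<N. root_of_unity N (k * int q)) = (if int N dvd k then of_nat N else 0)"
proof (cases "int N dvd k")
  case True
  then show ?thesis
    using root_of_unity_eq_1_iff[OF assms, of k] by (simp add: root_of_unity_mult_nat)
next
  case False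
  have "root_of_unity N k ^ N = 1"
    using root_of_unity_multiple[OF assms, of k] root_of_unity_mult_nat[of N k N]
    by (simp add: mult.commute)
  then show ?thesis
    using False root_of_unity_eq_1_iff[OF assms, of k]
    by (simp add: root_of_unity_mult_nat sum_gp_strict)
qed

text \<open>The residues of \<open>c, \<dots>, c + N - 1\<close> modulo \<open>N\<close> are a permutation of \<open>0, \<dots>, N - 1\<close>.\<close>

lemma sum_over_period_shift:
  fixes f :: "int \<Rightarrow> 'a :: comm_monoid_add"
  assumes "N \<ge> 1" and periodic: "\<And>i. f (i mod int N) = f i"
  shows "(\<Sum>q<N. f (int q + c)) = (\<Sum>k<N. f (int k))"
proof (rule sum.reindex_bij_witness[where
      j = "\<lambda>q. nat ((int q + c) mod int N)" and i = "\<lambda>k. nat ((int k - c) mod int N)"])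
  fix q assume "q \<in> {..<N}"
  then show "nat ((int (nat ((int q + c) mod int N)) - c) mod int N) = q"
    and "f (int (nat ((int q + c) mod int N))) = f (int q + c)"
    and "nat ((int q + c) mod int N) \<in> {..<N}"
    using assms(1) by (auto simp: periodic mod_diff_left_eq nat_less_iff)
next
  fix k assume "k \<in> {..<N}"
  then show "nat ((int (nat ((int k - c) mod int N)) + c) mod int N) = k"
    and "nat ((int k - c) mod int N) \<in> {..<N}"
    using assms(1) by (auto simp: mod_add_left_eq nat_less_iff)
qed

lemma circ_eigenvalue_root_of_unity:
  "circ_eigenvalue N a m = (\<Sum>k<N. of_real (a k) * root_of_unity N (- (int m * int k)))"
  by (simp add: circ_eigenvalue_def root_of_unity_def cis_conv_exp mult_ac)

text \<open>The substitution \<open>k = q + c\<close> turns the sum into the one that defines the eigenvalue and leaves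
  a constant factor. The rows of a circulant matrix and of its reversal are both cyclic shifts of
  \<open>a\<close>, so this formula evaluates both matrices on the waves.\<close>

lemma cyclic_correlation_with_root_of_unity:
  assumes "N \<ge> 1"
  shows "(\<Sum>q<N. of_real (a (nat ((int q + c) mod int N))) * root_of_unity N (- (int m * int q)))
    = root_of_unity N (int m * c) * circ_eigenvalue N a m"
proof -
  (* The summand in terms of k = q + c, extended periodically to all integers. *)
  define f where "f i = complex_of_real (a (nat (i mod int N))) *
    (root_of_unity N (int m * c) * root_of_unity N (- (int m * i)))" for i
  have "root_of_unity N (- (int m * (i mod int N))) = root_of_unity N (- (int m * i))" for i
  proof -
    have "- (int m * (i mod int N)) = - (int m * i) + int N * (int m * (i div int N))"
      by (simp add: algebra_simps flip: minus_mult_div_eq_mod)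
    then show ?thesis
      using root_of_unity_multiple[OF assms] by (simp only: root_of_unity_add mult.right_neutral)
  qed
  then have "f (i mod int N) = f i" for i by (simp add: f_def)
  from sum_over_period_shift[of N f, OF assms this, of c]
  have "(\<Sum>q<N. f (int q + c)) = (\<Sum>k<N. f (int k))" .
  moreover have "f (int q + c) = of_real (a (nat ((int q + c) mod int N))) *
      root_of_unity N (- (int m * int q))" for q
    unfolding f_def by (simp add: algebra_simps flip: root_of_unity_add)
  moreover have "(\<Sum>k<N. f (int k)) = root_of_unity N (int m * c) * circ_eigenvalue N a m"
    unfolding circ_eigenvalue_root_of_unity sum_distrib_left
    by (rule sum.cong) (simp_all add: f_def)
  ultimately show ?thesis by simp
qed

section \<open>The spectrum of a circulant matrix\<close>

lemma circ_eigenvalues: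
  assumes "N \<ge> 1"
  shows "eigenvalues_with_multiplicity (map_mat complex_of_real (circ N a))
    (map (circ_eigenvalue N a) [0..<N])"
proof (rule eigenvalues_from_biorthogonal_system[where d = "\<lambda>_. of_nat N" and
      v = "\<lambda>m q. root_of_unity N (- (int m * int q))" and
      u = "\<lambda>m q. root_of_unity N (int m * int q)"])
  fix m p assume "m < N" "p < N"
  then show "(\<Sum>q<N. map_mat complex_of_real (circ N a) $$ (p, q) *
      root_of_unity N (- (int m * int q))) =
      circ_eigenvalue N a m * root_of_unity N (- (int m * int p))"
    using cyclic_correlation_with_root_of_unity[OF assms, of a "- int p" m]
    by (simp add: circ_def mult.commute)
next
  fix l m assume lm: "l < N" "m < N"
  have "(\<Sum>q<N. root_of_unity N (int l * int q) * root_of_unity N (- (int m * int q)))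
      = (\<Sum>q<N. root_of_unity N ((int l - int m) * int q))"
    by (simp add: algebra_simps flip: root_of_unity_add)
  also have "\<dots> = (if int N dvd int l - int m then of_nat N else 0)"
    by (rule root_of_unity_orthogonality[OF assms])
  also have "int N dvd int l - int m \<longleftrightarrow> l = m"
    using lm by (auto simp: mod_eq_dvd_iff[symmetric])
  finally show "(\<Sum>q<N. root_of_unity N (int l * int q) * root_of_unity N (- (int m * int q)))
      = (if l = m then of_nat N else 0)" .
qed (use assms in \<open>auto simp: circ_def\<close>)

section \<open>The spectrum of a reversed-circulant matrix\<close>

lemma time_reversal_mult_index:
  assumes "A \<in> carrier_mat N M" "p < N" "q < M"
  shows "(time_reversal N * A) $$ (p, q) = A $$ (N - 1 - p, q)"
proof -
  have "(time_reversal N * A) $$ (p, q)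
      = (\<Sum>r<N. (if p + r + 2 = N + 1 then 1 else 0) * A $$ (r, q))"
    using assms by (simp add: time_reversal_def scalar_prod_def lessThan_atLeast0)
  also have "\<dots> = (\<Sum>r<N. if r = N - 1 - p then A $$ (r, q) else 0)"
    using assms by (intro sum.cong) auto
  also have "\<dots> = A $$ (N - 1 - p, q)" using assms by simp
  finally show ?thesis .
qed

lemma time_reversal_mult_circ_index:
  assumes "p < N" "q < N"
  shows "(time_reversal N * circ N a) $$ (p, q) = a (nat ((int q + (int p + 1)) mod int N))"
proof -
  have "(time_reversal N * circ N a) $$ (p, q)
      = a (nat ((int q - int (N - 1 - p)) mod int N))"
    using assms by (simp add: time_reversal_mult_index[of _ N N] circ_def)
  (* The extra N is a full period; it disappears modulo N. *)
  also have "int q - int (N - 1 - p) = int q + (int p + 1) - int N"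
    using assms by linarith
  also have "\<dots> mod int N = (int q + (int p + 1)) mod int N"
    by simp
  finally show ?thesis .
qed

text \<open>This is \<open>cos (\<phi> - 2 \<pi> m q / N)\<close>. As the real part of a complex wave it inherits the cyclic
  correlation formula and the orthogonality of the roots of unity.\<close>

definition cosine_wave :: "nat \<Rightarrow> real \<Rightarrow> nat \<Rightarrow> nat \<Rightarrow> real" where
  "cosine_wave N \<phi> m q = Re (cis \<phi> * root_of_unity N (- (int m * int q)))"

text \<open>The matrix turns the frequency \<open>-m\<close> into \<open>m\<close>. Conjugation turns it back without changing the
  real part, but it also reverses the rotation by \<open>\<phi>\<close>. This is why the condition on \<open>\<mu>\<close> contains
  the double angle: one \<open>\<phi>\<close> for the wave put in, another for the conjugated wave that comes out.\<close>

lemma time_reversal_mult_circ_cosine_wave: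
  assumes "N \<ge> 1" "p < N"
    and \<mu>: "cis (2 * \<phi>) * root_of_unity N (int m) * circ_eigenvalue N a m = of_real \<mu>"
  shows "(\<Sum>q<N. (time_reversal N * circ N a) $$ (p, q) * cosine_wave N \<phi> m q)
    = \<mu> * cosine_wave N \<phi> m p"
proof -
  have "(\<Sum>q<N. (time_reversal N * circ N a) $$ (p, q) * cosine_wave N \<phi> m q)
      = Re (cis \<phi> * (\<Sum>q<N. of_real (a (nat ((int q + (int p + 1)) mod int N))) *
          root_of_unity N (- (int m * int q))))"
    using assms(2) unfolding sum_distrib_left Re_sum
    by (intro sum.cong) (simp_all add: time_reversal_mult_circ_index cosine_wave_def algebra_simps)
  also have "\<dots> = Re (cis \<phi> * (root_of_unity N (int m * (int p + 1)) * circ_eigenvalue N a m))"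
    by (simp only: cyclic_correlation_with_root_of_unity[OF assms(1)])
  also have "cis \<phi> = cis (- \<phi>) * cis (2 * \<phi>)"
    by (simp add: cis_mult)
  also have "root_of_unity N (int m * (int p + 1))
      = root_of_unity N (int m * int p) * root_of_unity N (int m)"
    by (simp add: algebra_simps flip: root_of_unity_add)
  also have "cis (- \<phi>) * cis (2 * \<phi>) * (root_of_unity N (int m * int p) * root_of_unity N (int m) *
      circ_eigenvalue N a m) = of_real \<mu> * cnj (cis \<phi> * root_of_unity N (- (int m * int p)))"
    unfolding \<mu>[symmetric] by (simp add: cis_cnj cnj_root_of_unity mult_ac)
  also have "Re \<dots> = \<mu> * cosine_wave N \<phi> m p"
    by (simp add: cosine_wave_def)
  finally show ?thesis .
qed

text \<open>The product-to-sum formula splits a product of cosines into waves with the sum and the difference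
  of the frequencies; a wave sums to zero over a period unless its frequency is a multiple of \<open>N\<close>.\<close>

lemma cosine_wave_product_sum:
  assumes "N \<ge> 1"
  shows "(\<Sum>q<N. cosine_wave N \<phi> l q * cosine_wave N \<psi> m q)
    = real N / 2 * ((if N dvd l + m then cos (\<phi> + \<psi>) else 0)
        + (if int N dvd int l - int m then cos (\<phi> - \<psi>) else 0))"
proof -
  have cis_sum: "(\<Sum>q<N. Re (cis \<theta> * root_of_unity N (- k * int q)))
      = real N * (if int N dvd k then cos \<theta> else 0)" for \<theta> k
  proof -
    have "(\<Sum>q<N. Re (cis \<theta> * root_of_unity N (- k * int q)))
        = Re (cis \<theta> * (\<Sum>q<N. root_of_unity N (- k * int q)))"
      by (simp only: sum_distrib_left Re_sum)
    then show ?thesis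
      unfolding root_of_unity_orthogonality[OF assms] by simp
  qed
  have product: "Re z * Re w = (Re (z * w) + Re (z * cnj w)) / 2" for z w :: complex
    by simp
  have "cosine_wave N \<phi> l q * cosine_wave N \<psi> m q
      = (Re (cis (\<phi> + \<psi>) * root_of_unity N (- (int l + int m) * int q))
        + Re (cis (\<phi> - \<psi>) * root_of_unity N (- (int l - int m) * int q))) / 2" for q
  proof -
    have sum_exponent: "- (int l + int m) * int q = - (int l * int q) + - (int m * int q)"
      and diff_exponent: "- (int l - int m) * int q = - (int l * int q) + int m * int q"
      by (simp_all add: algebra_simps)
    have cis_minus_split: "cis (\<phi> - \<psi>) = cis \<phi> * cis (- \<psi>)"
      by (simp add: cis_mult)
    have "cis \<phi> * root_of_unity N (- (int l * int q)) *
        (cis \<psi> * root_of_unity N (- (int m * int q)))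
        = cis (\<phi> + \<psi>) * root_of_unity N (- (int l + int m) * int q)"
      unfolding sum_exponent root_of_unity_add cis_mult[symmetric] by (simp only: mult_ac)
    moreover have "cis \<phi> * root_of_unity N (- (int l * int q)) *
        cnj (cis \<psi> * root_of_unity N (- (int m * int q)))
        = cis (\<phi> - \<psi>) * root_of_unity N (- (int l - int m) * int q)"
      unfolding diff_exponent root_of_unity_add cis_minus_split complex_cnj_mult cis_cnj
        cnj_root_of_unity minus_minus by (simp only: mult_ac)
    ultimately show ?thesis
      unfolding cosine_wave_def product by simp
  qed
  then have "(\<Sum>q<N. cosine_wave N \<phi> l q * cosine_wave N \<psi> m q)
      = ((\<Sum>q<N. Re (cis (\<phi> + \<psi>) * root_of_unity N (- (int l + int m) * int q)))
        + (\<Sum>q<N. Re (cis (\<phi> - \<psi>) * root_of_unity N (- (int l - int m) * int q)))) / 2"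
    by (simp only: sum.distrib flip: sum_divide_distrib)
  moreover have "int N dvd int l + int m \<longleftrightarrow> N dvd l + m"
    by (metis int_dvd_int_iff of_nat_add)
  ultimately show ?thesis
    unfolding cis_sum by (simp add: distrib_left)
qed

text \<open>Opposite frequencies \<open>m\<close> and \<open>N - m\<close> span the same plane, and there the inner product is
  proportional to \<open>cos (\<phi> m + \<phi> (N - m))\<close>; complementary phases make it vanish. At a
  self-conjugate frequency the wave is nonzero only if \<open>cos (\<phi> m)\<close> is, which the phase \<open>0\<close>
  ensures; both terms of the product-to-sum formula then contribute, so its squared length is twice
  that of the other waves.\<close>

lemma cosine_wave_orthogonality:
  assumes "l < N" "m < N"
    and phases: "\<And>m. 0 < m \<Longrightarrow> m < N \<Longrightarrow> 2 * m \<noteq> N \<Longrightarrow> \<phi> m + \<phi> (N - m) = pi / 2"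
    and "\<phi> 0 = 0" and middle: "\<And>m. 2 * m = N \<Longrightarrow> \<phi> m = 0"
  shows "(\<Sum>q<N. cosine_wave N (\<phi> l) l q * cosine_wave N (\<phi> m) m q)
    = (if l = m then if N dvd 2 * m then real N else real N / 2 else 0)"
proof -
  have N: "N \<ge> 1" using assms(1) by simp
  have diff: "int N dvd int l - int m \<longleftrightarrow> l = m"
    using assms(1,2) by (auto simp: mod_eq_dvd_iff[symmetric])
  have opposite: "l + m = 0 \<or> l + m = N" if "N dvd l + m"
  proof -
    from that obtain k where k: "l + m = N * k" by (elim dvdE)
    then have "N * k < N * 2" using assms(1,2) by linarith
    then have "k = 0 \<or> k = 1" by auto
    then show ?thesis using k by auto
  qed
  show ?thesis
  proof (cases "l = m")
    case True
    have "cos (\<phi> m + \<phi> m) = 1" if "N dvd m + m"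
    proof -
      have "m = 0 \<or> 2 * m = N" using opposite that True by auto
      then have "\<phi> m = 0" using assms(4) middle by auto
      then show ?thesis by simp
    qed
    then show ?thesis
      unfolding True cosine_wave_product_sum[OF N] mult_2 by simp
  next
    case False
    have "cos (\<phi> l + \<phi> m) = 0" if "N dvd l + m"
    proof -
      have "l + m = N" using opposite[OF that] False by auto
      then have "m = N - l" "0 < l" "2 * l \<noteq> N" using False assms(2) by auto
      then have "\<phi> l + \<phi> m = pi / 2" using phases[of l] assms(1) by simp
      then show ?thesis by (simp only: cos_pi_half)
    qed
    then show ?thesis
      using False diff by (simp add: cosine_wave_product_sum[OF N])
  qed
qed

lemma circ_eigenvalue_0: "circ_eigenvalue N a 0 = of_real (\<Sum>k<N. a k)"
  by (simp add: circ_eigenvalue_root_of_unity)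

lemma root_of_unity_half:
  assumes "2 * m = N" "N \<ge> 1" shows "root_of_unity N (int m) = - 1"
proof -
  have "2 * pi * of_int (int m) / of_nat N = pi"
    using assms(2) unfolding assms(1)[symmetric] by simp
  then show ?thesis unfolding root_of_unity_def by simp
qed

text \<open>The coefficients \<open>a\<close> are real, so conjugation only inverts the roots of unity.\<close>

lemma circ_eigenvalue_opposite:
  assumes "m \<le> N" "N \<ge> 1"
  shows "circ_eigenvalue N a (N - m) = cnj (circ_eigenvalue N a m)"
proof -
  have "root_of_unity N (- (int (N - m) * int k)) = root_of_unity N (int m * int k)" for k
  proof -
    have "- (int (N - m) * int k) = int m * int k + int N * (- int k)"
      using assms(1) by (simp add: of_nat_diff algebra_simps)
    then show ?thesis
      using root_of_unity_multiple[OF assms(2), of "- int k"]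
      by (metis root_of_unity_add mult.right_neutral)
  qed
  then show ?thesis
    by (simp add: circ_eigenvalue_root_of_unity cnj_root_of_unity)
qed

lemma circ_eigenvalue_half_real:
  assumes "2 * m = N" "N \<ge> 1"
  shows "circ_eigenvalue N a m = of_real (Re (circ_eigenvalue N a m))"
proof -
  have "N - m = m" "m \<le> N" using assms(1) by auto
  then have "cnj (circ_eigenvalue N a m) = circ_eigenvalue N a m"
    using circ_eigenvalue_opposite[of m N a] assms(2) by simp
  then show ?thesis by (simp add: complex_eq_iff)
qed

text \<open>It remains to choose the phases. Strictly between \<open>0\<close> and \<open>N/2\<close> the phase makes the
  eigenvalue nonnegative. Above \<open>N/2\<close> orthogonality forces the complementary angle, up to
  multiples of \<open>\<pi>\<close>, and the resulting factor \<open>exp (\<i>\<pi>) = -1\<close> produces the opposite sign.\<close>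

lemma reversed_circulant_eigenvalues:
  assumes "N \<ge> 1"
  obtains \<mu> :: "nat \<Rightarrow> real" where
    "eigenvalues_with_multiplicity (time_reversal N * circ N a) (map \<mu> [0..<N])"
    "of_real (\<mu> 0) = circ_eigenvalue N a 0"
    "\<And>m. 0 < m \<Longrightarrow> 2 * m < N \<Longrightarrow> \<mu> m = cmod (circ_eigenvalue N a m)"
    "\<And>m. 0 < m \<Longrightarrow> 2 * m < N \<Longrightarrow> \<mu> (N - m) = - cmod (circ_eigenvalue N a m)"
    "\<And>m. 2 * m = N \<Longrightarrow> of_real (\<mu> m) = - circ_eigenvalue N a m"
proof -
  define c where "c m = root_of_unity N (int m) * circ_eigenvalue N a m" for m
  have norm_c: "cmod (c m) = cmod (circ_eigenvalue N a m)" for m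
    by (simp add: c_def norm_mult)
  have cnj_c: "c (N - m) = cnj (c m)" if "m \<le> N" for m
  proof -
    have "int (N - m) = - int m + int N * 1" using that by simp
    then have "root_of_unity N (int (N - m)) = root_of_unity N (- int m)"
      using root_of_unity_multiple[OF assms, of 1] by (metis root_of_unity_add mult.right_neutral)
    then show ?thesis
      using that assms by (simp add: c_def circ_eigenvalue_opposite cnj_root_of_unity)
  qed
  (* c m is the factor in R f_m = c m * f_(-m). Halving its argument is right because the
     eigenvalue involves twice the phase. *)
  define \<phi> where "\<phi> m =
    (if m = 0 \<or> 2 * m = N then 0
     else if 2 * m < N then - Arg (c m) / 2 else pi / 2 + Arg (c (N - m)) / 2)" for m
  define \<mu> where "\<mu> m =
    (if m = 0 \<or> 2 * m = N then Re (c m)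
     else if 2 * m < N then cmod (c m) else - cmod (c (N - m)))" for m
  have rotate: "cis (- Arg z) * z = of_real (cmod z)" for z
    using rcis_cmod_Arg[of z] unfolding rcis_def
    by (metis cis_mult add.left_inverse cis_zero mult.left_commute mult.right_neutral)
  have c_real: "of_real (Re (c m)) = c m" if "m = 0 \<or> 2 * m = N" for m
    using that
  proof
    assume "2 * m = N"
    then show ?thesis
      using circ_eigenvalue_half_real[of m N a] root_of_unity_half[of m N] assms
      by (simp add: c_def)
  qed (simp add: c_def circ_eigenvalue_0)
  have eigenvalue: "cis (2 * \<phi> m) * root_of_unity N (int m) * circ_eigenvalue N a m = of_real (\<mu> m)"
    if "m < N" for m
  proof -
    consider "m = 0 \<or> 2 * m = N" | "0 < m" "2 * m < N" | "N < 2 * m" by linarith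
    then have "cis (2 * \<phi> m) * c m = of_real (\<mu> m)"
    proof cases
      case 1
      then show ?thesis using c_real[OF 1] by (simp add: \<phi>_def \<mu>_def)
    next
      case 2
      then show ?thesis using rotate[of "c m"] by (simp add: \<phi>_def \<mu>_def)
    next
      case 3
      have "c m = cnj (c (N - m))" using cnj_c[of m] that by simp
      moreover have "cis (2 * \<phi> m) = - cis (Arg (c (N - m)))"
        using 3 by (simp add: \<phi>_def distrib_left flip: cis_mult)
      moreover have "cis (Arg (c (N - m))) * cnj (c (N - m)) = of_real (cmod (c (N - m)))"
        using arg_cong[OF rotate[of "c (N - m)"], of cnj] by (simp add: cis_cnj)
      ultimately show ?thesis using 3 by (simp add: \<mu>_def)
    qed
    then show ?thesis by (simp add: c_def mult.assoc)
  qed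
  have phases: "\<phi> m + \<phi> (N - m) = pi / 2" if "0 < m" "m < N" "2 * m \<noteq> N" for m
    using that by (auto simp: \<phi>_def)
  have "eigenvalues_with_multiplicity (time_reversal N * circ N a) (map \<mu> [0..<N])"
  proof (rule eigenvalues_from_biorthogonal_system[where
        v = "\<lambda>m. cosine_wave N (\<phi> m) m" and u = "\<lambda>m. cosine_wave N (\<phi> m) m" and
        d = "\<lambda>m. if N dvd 2 * m then real N else real N / 2"])
    show "time_reversal N * circ N a \<in> carrier_mat N N"
      unfolding time_reversal_def circ_def by (rule mult_carrier_mat) auto
  next
    fix m p assume "m < N" "p < N"
    then show "(\<Sum>q<N. (time_reversal N * circ N a) $$ (p, q) * cosine_wave N (\<phi> m) m q)
        = \<mu> m * cosine_wave N (\<phi> m) m p"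
      by (intro time_reversal_mult_circ_cosine_wave assms eigenvalue)
  next
    fix l m assume "l < N" "m < N"
    then show "(\<Sum>q<N. cosine_wave N (\<phi> l) l q * cosine_wave N (\<phi> m) m q)
        = (if l = m then if N dvd 2 * m then real N else real N / 2 else 0)"
      by (rule cosine_wave_orthogonality) (use phases in \<open>auto simp: \<phi>_def\<close>)
  qed (use assms in auto)
  moreover have "of_real (\<mu> 0) = circ_eigenvalue N a 0"
    by (simp add: \<mu>_def c_def circ_eigenvalue_0)
  moreover have "of_real (\<mu> m) = - circ_eigenvalue N a m" if "2 * m = N" for m
    using c_real[of m] that root_of_unity_half[OF that assms] by (simp add: \<mu>_def c_def)
  moreover have "\<mu> m = cmod (circ_eigenvalue N a m)" "\<mu> (N - m) = - cmod (circ_eigenvalue N a m)"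
    if "0 < m" "2 * m < N" for m
    using that norm_c by (auto simp: \<mu>_def)
  ultimately show thesis using that by blast
qed

theorem theorem5:
  fixes N :: nat and a :: "nat \<Rightarrow> real" and R :: "real mat"
  assumes "N \<ge> 1"
    and "R = time_reversal N * circ N a"
  shows "eigenvalues_with_multiplicity (map_mat complex_of_real (circ N a))
           (map (circ_eigenvalue N a) [0..<N]) \<and>
         reversed_circulant N R \<and>
         R \<in> carrier_mat N N \<and>
         (\<forall>p\<in>{1..N}. \<forall>q\<in>{1..N}. R $$ (p - 1, q - 1) = a ((p + q - 1) mod N)) \<and>
         (\<exists>\<mu> :: nat \<Rightarrow> real.
           eigenvalues_with_multiplicity R (map \<mu> [0..<N]) \<and>
           complex_of_real (\<mu> 0) = circ_eigenvalue N a 0 \<and>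
           (\<forall>m. 0 < m \<and> real m < real N / 2 \<longrightarrow>
              \<mu> m = cmod (circ_eigenvalue N a m) \<and> - \<mu> (N - m) = cmod (circ_eigenvalue N a m)) \<and>
           (even N \<longrightarrow> complex_of_real (\<mu> (N div 2)) = - circ_eigenvalue N a (N div 2)))"
proof (intro conjI)
  show "eigenvalues_with_multiplicity (map_mat complex_of_real (circ N a))
      (map (circ_eigenvalue N a) [0..<N])"
    by (rule circ_eigenvalues[OF assms(1)])
  show "reversed_circulant N R"
    using assms(2) by (auto simp: reversed_circulant_def)
  show "R \<in> carrier_mat N N"
    unfolding assms(2) time_reversal_def circ_def by (rule mult_carrier_mat) auto
  show "\<forall>p\<in>{1..N}. \<forall>q\<in>{1..N}. R $$ (p - 1, q - 1) = a ((p + q - 1) mod N)"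
  proof (intro ballI)
    fix p q assume pq: "p \<in> {1..N}" "q \<in> {1..N}"
    then have "int (q - 1) + (int (p - 1) + 1) = int (p + q - 1)" by auto
    then have "nat ((int (q - 1) + (int (p - 1) + 1)) mod int N) = (p + q - 1) mod N"
      by (simp only: nat_int flip: of_nat_mod)
    then show "R $$ (p - 1, q - 1) = a ((p + q - 1) mod N)"
      using pq time_reversal_mult_circ_index[of "p - 1" N "q - 1" a] by (simp only: assms(2)) auto
  qed
  obtain \<mu> :: "nat \<Rightarrow> real" where \<mu>:
    "eigenvalues_with_multiplicity (time_reversal N * circ N a) (map \<mu> [0..<N])"
    "of_real (\<mu> 0) = circ_eigenvalue N a 0"
    "\<And>m. 0 < m \<Longrightarrow> 2 * m < N \<Longrightarrow> \<mu> m = cmod (circ_eigenvalue N a m)"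
    "\<And>m. 0 < m \<Longrightarrow> 2 * m < N \<Longrightarrow> \<mu> (N - m) = - cmod (circ_eigenvalue N a m)"
    "\<And>m. 2 * m = N \<Longrightarrow> of_real (\<mu> m) = - circ_eigenvalue N a m"
    using reversed_circulant_eigenvalues[OF assms(1)] by blast
  have half: "2 * m < N" if "real m < real N / 2" for m
    using that by linarith
  show "\<exists>\<mu> :: nat \<Rightarrow> real.
      eigenvalues_with_multiplicity R (map \<mu> [0..<N]) \<and>
      complex_of_real (\<mu> 0) = circ_eigenvalue N a 0 \<and>
      (\<forall>m. 0 < m \<and> real m < real N / 2 \<longrightarrow>
         \<mu> m = cmod (circ_eigenvalue N a m) \<and> - \<mu> (N - m) = cmod (circ_eigenvalue N a m)) \<and>
      (even N \<longrightarrow> complex_of_real (\<mu> (N div 2)) = - circ_eigenvalue N a (N div 2))"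
    using \<mu> half assms(2) by (intro exI[of _ \<mu>]) auto
qed

end
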